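(* Let $(S,\cdot)$ be an adequate partial semigroup and let $A$ be a quasi-central subset of $S$. Let $\mathcal{F}$ be the collection of all adequate sequences in $S$. Then there exist functions $m:\mathcal{P}_f(\mathcal{F})\to\mathbb{N}$, $\alpha\in\prod_{F\in\mathcal{P}_f(\mathcal{F})}S^{m(F)+1}$, and $\tau\in\prod_{F\in\mathcal{P}_f(\mathcal{F})}\mathcal{J}_{m(F)}$ (Cartesian products) such that (1) if $F,G\in\mathcal{P}_f(\mathcal{F})$ and $F\subsetneq G$, then $\tau(F)(m(F))<\tau(G)(1)$, and (2) if $n\in\mathbb{N}$, $G_1,G_2,\ldots,G_n\in\mathcal{P}_f(\mathcal{F})$, $G_1\subsetneq G_2\subsetneq\cdots\subsetneq G_n$, and for each $i\in\{1,2,\ldots,n\}$, $f_i\in G_i$, then one has $$\prod_{i=1}^{n}\Big(\Big(\prod_{j=1}^{m(G_i)}\alpha(G_i)(j)\cdot f_i\big(\tau(G_i)(j)\big)\Big)\cdot\alpha(G_i)(m(G_i)+1)\Big)\in A.$$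
   Context: A partial semigroup is a pair $(S,\cdot)$ where $\cdot$ maps a subset of $S\times S$ to $S$ and for all $a,b,c\in S$, $(a\cdot b)\cdot c=a\cdot(b\cdot c)$ in the sense that if either side is defined, then so is the other and they are equal. For $s\in S$, $\phi(s)=\{t\in S: s\cdot t \text{ is defined}\}$; $\mathcal{P}_f(Y)$ is the set of nonempty finite subsets of $Y$; for $H\in\mathcal{P}_f(S)$, $\sigma(H)=\bigcap_{s\in H}\phi(s)$. $S$ is adequate if $\sigma(H)\neq\emptyset$ for every $H\in\mathcal{P}_f(S)$. $\beta S$ is the Stone-Čech compactification of the discrete space $S$ (the set of ultrafilters on $S$ with basic clopen sets $\overline{A}=\{p\in\beta S: A\in p\}$). $\delta S=\bigcap_{x\in S}cl_{\beta S}(\phi(x))$. For $x\in S$, $A\subseteq S$: $x^{-1}A=\{y\in\phi(x): x\cdot y\in A\}$. For $p\in\beta S$, $q\in\delta S$, $p\cdot q$ is the ultrafilter with $A\in p\cdot q\iff\{x\in S: x^{-1}A\in q\}\in p$. With this operation $\delta S$ is a compact Hausdorff right topological semigroup; $K(\delta S)$ denotes its smallest two-sided ideal. $A\subseteq S$ is quasi-central if and only if there is an idempotent $p$ in $cl\,K(\delta S)$ such that $A\in p$. $\mathbb{N}$ is the set of positive integers. A sequence $f:\mathbb{N}\to S$ is adequate if (i) for each $H\in\mathcal{P}_f(\mathbb{N})$ the product $\prod_{t\in H}f(t)$ (taken in increasing order of indices) is defined, and (ii) for each $F\in\mathcal{P}_f(S)$ there is $k\in\mathbb{N}$ such that $\prod_{t\in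 H}f(t)\in\sigma(F)$ for every $H\in\mathcal{P}_f(\mathbb{N})$ with $\min H\geq k$. For $m\in\mathbb{N}$, $\mathcal{J}_m=\{t\in\mathbb{N}^m: t(1)<t(2)<\cdots<t(m)\}$. All products in $S$ are taken in increasing order of indices; the assertion that a product lies in $A$ includes that it is defined. *)

theory Defs
  imports "HOL-Analysis.Analysis"
begin

text \<open>
  The set \<open>S\<close> is the type \<open>'a\<close>; the partial operation is \<open>op :: 'a \<Rightarrow> 'a \<Rightarrow> 'a option\<close>, with
  \<open>None\<close> for undefined. The positive integers are the set \<open>{1..} :: nat set\<close>, and functions with a
  restricted domain are extensional functions (\<open>\<rightarrow>\<^sub>E\<close>), so that they are determined by their values there.
\<close>

definition Pf :: "'b set \<Rightarrow> 'b set set" where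
  "Pf Y = {H. H \<subseteq> Y \<and> finite H \<and> H \<noteq> {}}"


subsection \<open>Partial semigroups\<close>

definition opt_mult :: "('a \<Rightarrow> 'a \<Rightarrow> 'a option) \<Rightarrow> 'a option \<Rightarrow> 'a option \<Rightarrow> 'a option" where
  "opt_mult op u v = Option.bind u (\<lambda>x. Option.bind v (\<lambda>y. op x y))"

text \<open>Equality in \<open>'a option\<close> says: if either side is defined, so is the other and they are equal.\<close>

definition partial_semigroup :: "('a \<Rightarrow> 'a \<Rightarrow> 'a option) \<Rightarrow> bool" where
  "partial_semigroup op \<longleftrightarrow>
     (\<forall>a b c. opt_mult op (op a b) (Some c) = opt_mult op (Some a) (op b c))"

definition phi :: "('a \<Rightarrow> 'a \<Rightarrow> 'a option) \<Rightarrow> 'a \<Rightarrow> 'a set" where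
  "phi op s = {t. op s t \<noteq> None}"

definition sigma :: "('a \<Rightarrow> 'a \<Rightarrow> 'a option) \<Rightarrow> 'a set \<Rightarrow> 'a set" where
  "sigma op H = (\<Inter>s\<in>H. phi op s)"

definition adequate_partial_semigroup :: "('a \<Rightarrow> 'a \<Rightarrow> 'a option) \<Rightarrow> bool" where
  "adequate_partial_semigroup op \<longleftrightarrow>
     partial_semigroup op \<and> (\<forall>H \<in> Pf UNIV. sigma op H \<noteq> {})"


subsection \<open>Finite products and adequate sequences\<close>

text \<open>
  A product is defined only if all its factors and all intermediate products are. In a partial
  semigroup the bracketing is irrelevant. Empty products do not occur; the value \<open>None\<close> for them is
  a dummy.
\<close>

fun list_prod :: "('a \<Rightarrow> 'a \<Rightarrow> 'a option) \<Rightarrow> 'a option list \<Rightarrow> 'a option" where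
  "list_prod op [] = None"
| "list_prod op [u] = u"
| "list_prod op (u # v # us) = opt_mult op u (list_prod op (v # us))"

text \<open>The product of the \<open>u t\<close>, \<open>t \<in> H\<close>, in increasing order of indices, for finite \<open>H\<close>.\<close>

definition ordered_prod ::
    "('a \<Rightarrow> 'a \<Rightarrow> 'a option) \<Rightarrow> (nat \<Rightarrow> 'a option) \<Rightarrow> nat set \<Rightarrow> 'a option" where
  "ordered_prod op u H = list_prod op (map u (sorted_list_of_set H))"

definition adequate_sequence :: "('a \<Rightarrow> 'a \<Rightarrow> 'a option) \<Rightarrow> (nat \<Rightarrow> 'a) \<Rightarrow> bool" where
  "adequate_sequence op f \<longleftrightarrow>
     f \<in> {1..} \<rightarrow>\<^sub>E UNIV \<and>
     (\<forall>H \<in> Pf {1..}. ordered_prod op (\<lambda>t. Some (f t)) H \<noteq> None) \<and>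
     (\<forall>F \<in> Pf UNIV. \<exists>k \<ge> 1. \<forall>H \<in> Pf {1..}. Min H \<ge> k \<longrightarrow>
        (\<exists>x \<in> sigma op F. ordered_prod op (\<lambda>t. Some (f t)) H = Some x))"

definition increasing_tuples :: "nat \<Rightarrow> (nat \<Rightarrow> nat) set" where
  "increasing_tuples m = {t \<in> {1..m} \<rightarrow>\<^sub>E {1..}. strict_mono_on {1..m} t}"


subsection \<open>The Stone-Cech compactification and quasi-central sets\<close>

definition ultrafilter :: "'a set set \<Rightarrow> bool" where
  "ultrafilter p \<longleftrightarrow>
     UNIV \<in> p \<and> {} \<notin> p \<and>
     (\<forall>A B. A \<in> p \<and> B \<in> p \<longrightarrow> A \<inter> B \<in> p) \<and>
     (\<forall>A B. A \<in> p \<and> A \<subseteq> B \<longrightarrow> B \<in> p) \<and>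
     (\<forall>A. A \<in> p \<or> - A \<in> p)"

definition beta :: "'a set set topology" where
  "beta = topology_generated_by (range (\<lambda>A. {p. ultrafilter p \<and> A \<in> p}))"

text \<open>The embedding of the discrete space \<open>S\<close> into \<open>\<beta>S\<close>.\<close>

definition principal_uf :: "'a \<Rightarrow> 'a set set" where
  "principal_uf x = {A. x \<in> A}"

definition delta :: "('a \<Rightarrow> 'a \<Rightarrow> 'a option) \<Rightarrow> 'a set set set" where
  "delta op = (\<Inter>x. beta closure_of (principal_uf ` phi op x))"

definition left_quotient :: "('a \<Rightarrow> 'a \<Rightarrow> 'a option) \<Rightarrow> 'a \<Rightarrow> 'a set \<Rightarrow> 'a set" where
  "left_quotient op x A = {y \<in> phi op x. the (op x y) \<in> A}"

text \<open>Meaningful for \<open>p \<in> \<beta>S\<close> and \<open>q \<in> \<delta>S\<close> only.\<close>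

definition uf_mult :: "('a \<Rightarrow> 'a \<Rightarrow> 'a option) \<Rightarrow> 'a set set \<Rightarrow> 'a set set \<Rightarrow> 'a set set" where
  "uf_mult op p q = {A. {x. left_quotient op x A \<in> q} \<in> p}"

definition delta_ideal :: "('a \<Rightarrow> 'a \<Rightarrow> 'a option) \<Rightarrow> 'a set set set \<Rightarrow> bool" where
  "delta_ideal op I \<longleftrightarrow>
     I \<subseteq> delta op \<and> I \<noteq> {} \<and>
     (\<forall>p \<in> delta op. \<forall>q \<in> I. uf_mult op p q \<in> I \<and> uf_mult op q p \<in> I)"

text \<open>
  A compact Hausdorff right topological semigroup has a smallest two-sided ideal, which is then the
  intersection of all two-sided ideals.
\<close>

definition K_delta :: "('a \<Rightarrow> 'a \<Rightarrow> 'a option) \<Rightarrow> 'a set set set" where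
  "K_delta op = \<Inter> {I. delta_ideal op I}"

text \<open>As \<open>\<delta>S\<close> is closed in \<open>\<beta>S\<close>, closures of its subsets in \<open>\<delta>S\<close> and in \<open>\<beta>S\<close> agree.\<close>

definition quasi_central :: "('a \<Rightarrow> 'a \<Rightarrow> 'a option) \<Rightarrow> 'a set \<Rightarrow> bool" where
  "quasi_central op A \<longleftrightarrow>
     (\<exists>p \<in> beta closure_of (K_delta op). uf_mult op p p = p \<and> A \<in> p)"

end

theory Submission
  imports Defs
begin

text \<open>
  Call \<open>B\<close> a J-set if for every finite set \<open>F\<close> of adequate sequences and every \<open>l\<close> a single choice of
  \<open>\<alpha>\<close> and of \<open>\<tau>\<close> with \<open>\<tau>(1) > l\<close> makes the products for all \<open>f \<in> F\<close> land in \<open>B\<close>. The \<open>p \<in> \<delta>S\<close> all of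
  whose members are J-sets form a two-sided ideal of \<open>\<delta>S\<close>: multiplication by a fixed element from the left is
  absorbed into \<open>\<alpha>(1)\<close>, from the right into \<open>\<alpha>(m + 1)\<close>, and the ideal is nonempty because, by the
  Hales-Jewett theorem, finitely many sets covering some \<open>\<sigma>(H)\<close> always include a J-set. So the ideal contains
  \<open>K(\<delta>S)\<close>, and members of ultrafilters in its closure are J-sets as well. Given an idempotent \<open>p\<close> in this
  closure with \<open>A \<in> p\<close>, put \<open>A\<^sup>* = {x \<in> A. x\<^sup>-\<^sup>1A \<in> p}\<close> and define \<open>\<alpha>(F)\<close> and \<open>\<tau>(F)\<close> by recursion on \<open>F\<close>, using
  that the intersection of \<open>A\<^sup>*\<close> with the sets \<open>x\<^sup>-\<^sup>1A\<^sup>*\<close>, \<open>x\<close> a product along a chain of proper subsets of \<open>F\<close>,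
  belongs to \<open>p\<close> and hence is a J-set.
\<close>

subsection \<open>The Hales-Jewett theorem\<close>

definition fill :: "'a \<Rightarrow> 'a option list \<Rightarrow> 'a list" where
  "fill x v = map (case_option x id) v"

definition words :: "'a set \<Rightarrow> nat \<Rightarrow> 'a list set" where
  "words X n = {w. set w \<subseteq> X \<and> length w = n}"

definition variable_words :: "'a set \<Rightarrow> nat \<Rightarrow> 'a option list set" where
  "variable_words X n = {v \<in> words (insert None (Some ` X)) n. None \<in> set v}"

lemma fill_append: "fill x (v @ w) = fill x v @ fill x w"
  by (simp add: fill_def)

lemma fill_map_Some: "fill x (map Some w) = w"
  by (induction w) (auto simp: fill_def)

lemma words_append: "v \<in> words X m \<Longrightarrow> w \<in> words X n \<Longrightarrow> v @ w \<in> words X (m + n)"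
  by (auto simp: words_def)

lemma words_mono: "X \<subseteq> Y \<Longrightarrow> words X n \<subseteq> words Y n"
  by (auto simp: words_def)

lemma fill_in_words:
  assumes "v \<in> variable_words X n" "X \<subseteq> Y" "x \<in> Y"
  shows "fill x v \<in> words Y n"
  using assms by (fastforce simp: variable_words_def words_def fill_def)

lemma variable_words_append:
  assumes "v \<in> variable_words X m" "w \<in> words (insert None (Some ` X)) n"
  shows "v @ w \<in> variable_words X (m + n)"
  using assms by (auto simp: variable_words_def words_def)

lemma variable_words_append':
  assumes "v \<in> words X m" "w \<in> variable_words X n"
  shows "map Some v @ w \<in> variable_words X (m + n)"
  using assms by (auto simp: variable_words_def words_def)

lemma map_Some_in_words: "w \<in> words X n \<Longrightarrow> map Some w \<in> words (insert None (Some ` X)) n"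
  by (auto simp: words_def)

lemma variable_words_mono: "X \<subseteq> Y \<Longrightarrow> variable_words X n \<subseteq> variable_words Y n"
  by (auto simp: variable_words_def words_def)

lemma finite_words: "finite X \<Longrightarrow> finite (words X n)"
  by (simp add: words_def finite_lists_length_eq)

text \<open>Colour focusing: variable words over \<open>insert z X\<close> that agree at \<open>z\<close> are collected until their colours
  on \<open>X\<close>, which are pairwise distinct, exceed the number of available colours.\<close>

lemma hales_jewett_nat:
  assumes "finite X" "X \<noteq> {}"
  shows "\<exists>n. \<forall>c :: 'a list \<Rightarrow> nat. c ` words X n \<subseteq> {..<r} \<longrightarrow>
           (\<exists>v \<in> variable_words X n. \<exists>d. \<forall>x\<in>X. c (fill x v) = d)"
  using assms
proof (induction X arbitrary: r rule: finite_ne_induct)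
  case (singleton a)
  have "[None] \<in> variable_words {a} 1"
    by (auto simp: variable_words_def words_def)
  then show ?case
    by (intro exI[of _ 1]) blast
next
  case (insert z X)
  define Y where "Y = insert z X"
  obtain x0 where x0: "x0 \<in> X"
    using insert.hyps by blast
  have XY: "X \<subseteq> Y" "z \<in> Y" and finY: "finite Y"
    using insert.hyps by (auto simp: Y_def)
  define mono where "mono n c \<longleftrightarrow> (\<exists>v \<in> variable_words Y n. \<exists>d. \<forall>x\<in>Y. c (fill x v) = d)"
    for n and c :: "'a list \<Rightarrow> nat"
  define focused where "focused n c D u \<longleftrightarrow>
      u \<in> words Y n \<and> (\<forall>d\<in>D. \<exists>v \<in> variable_words Y n. fill z v = u \<and> (\<forall>x\<in>X. c (fill x v) = d))"
    for n D u and c :: "'a list \<Rightarrow> nat"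
  \<comment> \<open>Each round of this induction lengthens the words and gains one focused colour,
    unless a monochromatic variable word appears.\<close>
  have "\<exists>n. \<forall>c. c ` words Y n \<subseteq> {..<r} \<longrightarrow>
          mono n c \<or> (\<exists>u D. D \<subseteq> {..<r} \<and> card D = s \<and> focused n c D u)" for s
  proof (induction s)
    case 0
    have "focused 0 c {} []" for c
      by (simp add: focused_def words_def)
    then show ?case
      using card.empty by blast
  next
    case (Suc s)
    then obtain n where n: "\<And>c. c ` words Y n \<subseteq> {..<r} \<Longrightarrow>
          mono n c \<or> (\<exists>u D. D \<subseteq> {..<r} \<and> card D = s \<and> focused n c D u)"
      by blast
    let ?U = "words Y n"
    \<comment> \<open>A word \<open>w\<close> will be coloured by the whole colouring that it
      induces on suffixes. There are finitely many of these, numbered by \<open>g\<close>. Their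
      number \<open>q\<close> is the reason why the induction on \<open>X\<close> keeps the number
      of colours arbitrary.\<close>
    have "finite (?U \<rightarrow>\<^sub>E {..<r})"
      by (intro finite_PiE finite_words finY) auto
    then obtain g :: "('a list \<Rightarrow> nat) \<Rightarrow> nat" and q
      where g: "g ` (?U \<rightarrow>\<^sub>E {..<r}) = {i. i < q}" "inj_on g (?U \<rightarrow>\<^sub>E {..<r})"
      using finite_imp_inj_to_nat_seg by metis
    obtain N where N: "\<And>c. c ` words X N \<subseteq> {..<q} \<Longrightarrow>
           (\<exists>v \<in> variable_words X N. \<exists>d. \<forall>x\<in>X. c (fill x v) = d)"
      using insert.IH by blast
    have "mono (N + n) c \<or> (\<exists>u D. D \<subseteq> {..<r} \<and> card D = Suc s \<and> focused (N + n) c D u)"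
      if c: "c ` words Y (N + n) \<subseteq> {..<r}" for c
    proof -
      have cr: "c (w @ u) < r" if "w \<in> words Y N" "u \<in> ?U" for w u
        using c words_append[OF that] by blast
      define h where "h w = restrict (\<lambda>u. c (w @ u)) ?U" for w
      have h: "h w \<in> ?U \<rightarrow>\<^sub>E {..<r}" if "w \<in> words Y N" for w
        using cr[OF that] by (auto simp: h_def)
      have "(\<lambda>w. g (h w)) ` words X N \<subseteq> {..<q}"
        using g(1) h words_mono[OF XY(1)] by blast
      then obtain v d0 where v: "v \<in> variable_words X N" and d0: "\<And>x. x \<in> X \<Longrightarrow> g (h (fill x v)) = d0"
        using N[of "\<lambda>w. g (h w)"] by blast
      have vY: "fill x v \<in> words Y N" if "x \<in> Y" for x
        using fill_in_words[OF v XY(1) that] .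
      have vVY: "v \<in> variable_words Y N"
        using v variable_words_mono[OF XY(1)] by blast
      \<comment> \<open>For each suffix in \<open>?U\<close> the colour is the same at all
        \<open>x\<close> in \<open>X\<close>, so the colouring induced at \<open>x0\<close>
        represents them all; the colours at \<open>z\<close> remain free.\<close>
      define c' where "c' u = c (fill x0 v @ u)" for u
      have indep: "c (fill x v @ u) = c' u" if "x \<in> X" "u \<in> ?U" for x u
      proof -
        have "h (fill x v) = h (fill x0 v)"
          using inj_onD[OF g(2), of "h (fill x v)" "h (fill x0 v)"] d0[OF that(1)] d0[OF x0]
            h[OF vY] that(1) x0 XY(1) by auto
        then have "h (fill x v) u = h (fill x0 v) u"
          by simp
        then show ?thesis
          using that by (simp add: h_def c'_def)
      qed
      have c': "c' ` ?U \<subseteq> {..<r}"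
        using cr vY x0 XY by (auto simp: c'_def)
      have mono_c: "mono (N + n) c" if mono_c': "mono n c'"
      proof -
        obtain w d where w: "w \<in> variable_words Y n" "\<forall>x\<in>Y. c' (fill x w) = d"
          using mono_c' unfolding mono_def by blast
        have "map Some (fill x0 v) @ w \<in> variable_words Y (N + n)"
          using variable_words_append'[OF vY w(1)] x0 XY by blast
        moreover have "\<forall>x\<in>Y. c (fill x (map Some (fill x0 v) @ w)) = d"
          using w(2) by (simp add: fill_append fill_map_Some c'_def)
        ultimately show ?thesis
          unfolding mono_def by blast
      qed
      consider "mono n c'" | u D where "D \<subseteq> {..<r}" "card D = s" "focused n c' D u"
        using n[OF c'] by blast
      then show ?thesis
      proof cases
        case 1
        then show ?thesis
          using mono_c by blast
      next
        case 2
        then have u: "u \<in> ?U"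
          by (simp add: focused_def)
        have D: "\<exists>w \<in> variable_words Y n. fill z w = u \<and> (\<forall>x\<in>X. c' (fill x w) = d)" if "d \<in> D" for d
          using 2(3) that by (simp add: focused_def)
        \<comment> \<open>If the colour of \<open>u\<close> is already focused, the corresponding
          variable word has this colour at \<open>z\<close> too and is monochromatic on
          \<open>Y\<close>. Otherwise the colour is new and enlarges \<open>D\<close>.\<close>
        show ?thesis
        proof (cases "c' u \<in> D")
          case True
          then have "mono n c'"
            using D[OF True] by (force simp: mono_def Y_def)
          then show ?thesis
            using mono_c by blast
        next
          case False
          have "\<exists>w \<in> variable_words Y (N + n). fill z w = fill z v @ u \<and> (\<forall>x\<in>X. c (fill x w) = d)"
            if "d \<in> insert (c' u) D" for d
          proof (cases "d = c' u")
            case True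
            \<comment> \<open>The new colour comes from varying \<open>v\<close> alone and keeping
              \<open>u\<close> fixed; for an old colour, \<open>v\<close> and its word
              \<open>w\<close> vary together. Both kinds become \<open>fill z v @ u\<close> at
              \<open>z\<close>.\<close>
            have "v @ map Some u \<in> variable_words Y (N + n)"
              using variable_words_append[OF vVY map_Some_in_words[OF u]] .
            then show ?thesis
              using True indep u by (intro bexI[of _ "v @ map Some u"]) (auto simp: fill_append fill_map_Some)
          next
            case False
            then obtain w where w: "w \<in> variable_words Y n" "fill z w = u" "\<forall>x\<in>X. c' (fill x w) = d"
              using D \<open>d \<in> insert (c' u) D\<close> by blast
            have "v @ w \<in> variable_words Y (N + n)"
              using variable_words_append[OF vVY] w(1) by (simp add: variable_words_def)
            moreover have "c (fill x (v @ w)) = d" if "x \<in> X" for x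
              using w(3) indep that XY fill_in_words[OF w(1) order_refl] by (auto simp: fill_append)
            ultimately show ?thesis
              using w(2) by (intro bexI[of _ "v @ w"]) (auto simp: fill_append)
          qed
          then have "focused (N + n) c (insert (c' u) D) (fill z v @ u)"
            using words_append[OF vY[OF XY(2)] u] by (auto simp: focused_def)
          moreover have "insert (c' u) D \<subseteq> {..<r}"
            using 2(1) c' u by blast
          moreover have "card (insert (c' u) D) = Suc s"
            using False 2(1,2) finite_subset[OF 2(1)] by simp
          ultimately show ?thesis
            by blast
        qed
      qed
    qed
    then show ?case
      by blast
  qed
  from this[of "Suc r"] obtain n where n: "\<And>c. c ` words Y n \<subseteq> {..<r} \<Longrightarrow>
          mono n c \<or> (\<exists>u D. D \<subseteq> {..<r} \<and> card D = Suc r \<and> focused n c D u)"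
    by blast
  \<comment> \<open>Only \<open>r\<close> colours exist, so \<open>Suc r\<close> distinct focused
    ones are impossible.\<close>
  have "mono n c" if "c ` words Y n \<subseteq> {..<r}" for c
    using n[OF that] card_mono[of "{..<r}"] by (metis card_lessThan finite_lessThan not_less_eq_eq order_refl)
  then show ?case
    unfolding mono_def Y_def by blast
qed

lemma hales_jewett:
  assumes "finite X" "X \<noteq> {}" "finite C"
  obtains n where "\<And>c :: 'a list \<Rightarrow> 'c. c ` words X n \<subseteq> C \<Longrightarrow>
           (\<exists>v \<in> variable_words X n. \<exists>d \<in> C. \<forall>x\<in>X. c (fill x v) = d)"
proof -
  obtain g :: "'c \<Rightarrow> nat" and r where g: "g ` C = {i. i < r}" "inj_on g C"
    using finite_imp_inj_to_nat_seg[OF assms(3)] by metis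
  obtain n where n: "\<And>c :: 'a list \<Rightarrow> nat. c ` words X n \<subseteq> {..<r} \<Longrightarrow>
           (\<exists>v \<in> variable_words X n. \<exists>d. \<forall>x\<in>X. c (fill x v) = d)"
    using hales_jewett_nat[OF assms(1,2)] by blast
  obtain x0 where x0: "x0 \<in> X"
    using assms(2) by blast
  show thesis
  proof
    fix c :: "'a list \<Rightarrow> 'c"
    assume c: "c ` words X n \<subseteq> C"
    then have "(\<lambda>w. g (c w)) ` words X n \<subseteq> {..<r}"
      using g(1) by blast
    then obtain v d where v: "v \<in> variable_words X n" and d: "\<And>x. x \<in> X \<Longrightarrow> g (c (fill x v)) = d"
      using n[of "\<lambda>w. g (c w)"] by blast
    have "c (fill x v) \<in> C" if "x \<in> X" for x
      using c fill_in_words[OF v order_refl that] by blast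
    then have "\<forall>x\<in>X. c (fill x v) = c (fill x0 v)"
      using d x0 inj_onD[OF g(2)] by auto
    then show "\<exists>v \<in> variable_words X n. \<exists>d \<in> C. \<forall>x\<in>X. c (fill x v) = d"
      using v x0 \<open>\<And>x. x \<in> X \<Longrightarrow> c (fill x v) \<in> C\<close> by blast
  qed
qed

subsection \<open>Ultrafilters and the topology of \<open>\<beta>S\<close>\<close>

lemma ultrafilterD:
  assumes "ultrafilter p"
  shows ultrafilter_UNIV: "UNIV \<in> p"
    and ultrafilter_empty: "{} \<notin> p"
    and ultrafilter_Int: "A \<in> p \<Longrightarrow> B \<in> p \<Longrightarrow> A \<inter> B \<in> p"
    and ultrafilter_mono: "A \<in> p \<Longrightarrow> A \<subseteq> B \<Longrightarrow> B \<in> p"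
    and ultrafilter_Compl: "- A \<in> p \<longleftrightarrow> A \<notin> p"
proof -
  show *: "UNIV \<in> p" "{} \<notin> p" "A \<in> p \<Longrightarrow> B \<in> p \<Longrightarrow> A \<inter> B \<in> p" "A \<in> p \<Longrightarrow> A \<subseteq> B \<Longrightarrow> B \<in> p" for A B
    using assms unfolding ultrafilter_def by blast+
  have "A \<in> p \<or> - A \<in> p" for A
    using assms unfolding ultrafilter_def by blast
  then show "- A \<in> p \<longleftrightarrow> A \<notin> p"
    using *(2) *(3)[of A "- A"] by (metis Compl_disjoint)
qed

lemma ultrafilter_Int_iff: "ultrafilter p \<Longrightarrow> A \<inter> B \<in> p \<longleftrightarrow> A \<in> p \<and> B \<in> p"
  by (meson inf_le1 inf_le2 ultrafilter_Int ultrafilter_mono)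

lemma ultrafilter_INT:
  assumes "ultrafilter p" "finite I" "\<And>i. i \<in> I \<Longrightarrow> f i \<in> p"
  shows "(\<Inter>i\<in>I. f i) \<in> p"
  using assms(2,3)
  by (induction I rule: finite_induct)
    (auto simp: ultrafilter_UNIV[OF assms(1)] ultrafilter_Int[OF assms(1)])

text \<open>By Zorn's lemma there is a maximal family with the finite intersection property.
  Maximality puts into it every set that meets all its finite intersections (\<open>in_p\<close>),
  and each ultrafilter axiom follows from that.\<close>

lemma ultrafilter_extension:
  assumes fip: "\<And>X. finite X \<Longrightarrow> X \<subseteq> \<B> \<Longrightarrow> \<Inter>X \<noteq> {}"
  obtains p where "ultrafilter p" "\<B> \<subseteq> p"
proof -
  define Fip where "Fip = {p. \<B> \<subseteq> p \<and> (\<forall>X. finite X \<and> X \<subseteq> p \<longrightarrow> \<Inter>X \<noteq> {})}"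
  have "\<exists>p\<in>Fip. \<forall>X\<in>Fip. p \<subseteq> X \<longrightarrow> X = p"
  proof (rule subset_Zorn_nonempty)
    show "Fip \<noteq> {}"
      using fip by (auto simp: Fip_def)
  next
    fix \<C> assume \<C>: "\<C> \<noteq> {}" "subset.chain Fip \<C>"
    have "\<Inter>X \<noteq> {}" if X: "finite X" "X \<subseteq> \<Union>\<C>" for X
    proof -
      obtain c where "c \<in> \<C>" "X \<subseteq> c"
        using finite_subset_Union_chain[OF X \<C>] by blast
      moreover have "c \<in> Fip"
        using \<C>(2) calculation(1) by (auto simp: subset.chain_def)
      ultimately show ?thesis
        using X(1) by (simp add: Fip_def)
    qed
    moreover have "\<B> \<subseteq> \<Union>\<C>"
    proof -
      obtain c where "c \<in> \<C>"
        using \<C>(1) by blast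
      moreover have "\<B> \<subseteq> c"
        using \<C>(2) calculation by (auto simp: subset.chain_def Fip_def)
      ultimately show ?thesis
        by blast
    qed
    ultimately show "\<Union>\<C> \<in> Fip"
      by (simp add: Fip_def)
  qed
  then obtain p where p: "p \<in> Fip" and max: "\<And>X. X \<in> Fip \<Longrightarrow> p \<subseteq> X \<Longrightarrow> X = p"
    by blast
  have fip_p: "\<Inter>X \<noteq> {}" if "finite X" "X \<subseteq> p" for X
    using p that by (simp add: Fip_def)
  have in_p: "A \<in> p" if A: "\<And>X. finite X \<Longrightarrow> X \<subseteq> p \<Longrightarrow> A \<inter> \<Inter>X \<noteq> {}" for A
  proof -
    have "\<Inter>X \<noteq> {}" if "finite X" "X \<subseteq> insert A p" for X
    proof -
      have "A \<inter> \<Inter>(X - {A}) \<noteq> {}"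
        using that by (intro A) auto
      moreover have "A \<inter> \<Inter>(X - {A}) \<subseteq> \<Inter>X"
        by blast
      ultimately show ?thesis
        by blast
    qed
    moreover have "\<B> \<subseteq> insert A p"
      using p by (auto simp: Fip_def)
    ultimately have "insert A p \<in> Fip"
      by (simp add: Fip_def)
    then show ?thesis
      using max by blast
  qed
  have "ultrafilter p"
    unfolding ultrafilter_def
  proof (intro conjI allI impI)
    show "UNIV \<in> p"
      by (rule in_p) (simp add: fip_p)
    show "{} \<notin> p"
      using fip_p[of "{{}}"] by auto
    show "A \<inter> B \<in> p" if "A \<in> p \<and> B \<in> p" for A B
    proof (rule in_p)
      fix X assume "finite X" "X \<subseteq> p"
      then show "A \<inter> B \<inter> \<Inter>X \<noteq> {}"
        using fip_p[of "{A, B} \<union> X"] that by auto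
    qed
    show "B \<in> p" if "A \<in> p \<and> A \<subseteq> B" for A B
    proof (rule in_p)
      fix X assume "finite X" "X \<subseteq> p"
      then show "B \<inter> \<Inter>X \<noteq> {}"
        using fip_p[of "insert A X"] that by auto
    qed
    show "A \<in> p \<or> - A \<in> p" for A
    proof (rule ccontr)
      assume "\<not> (A \<in> p \<or> - A \<in> p)"
      \<comment> \<open>A set outside \<open>p\<close> misses some finite intersection of members;
        combining the families for \<open>A\<close> and for its complement leaves no point at
        all.\<close>
      then obtain X Y where "finite X" "X \<subseteq> p" "A \<inter> \<Inter>X = {}" "finite Y" "Y \<subseteq> p" "- A \<inter> \<Inter>Y = {}"
        using in_p[of A] in_p[of "- A"] by metis
      moreover from this have "\<Inter>(X \<union> Y) = {}"
        unfolding Inter_Un_distrib by blast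
      ultimately have "finite (X \<union> Y)" "X \<union> Y \<subseteq> p" "\<Inter>(X \<union> Y) = {}"
        by simp_all
      then show False
        using fip_p by blast
    qed
  qed
  moreover have "\<B> \<subseteq> p"
    using p by (simp add: Fip_def)
  ultimately show thesis
    by (rule that)
qed

lemma topspace_beta: "topspace beta = {p. ultrafilter p}"
  unfolding beta_def topology_generated_by_topspace using ultrafilter_UNIV by blast

lemma openin_beta_basic: "openin beta {p. ultrafilter p \<and> A \<in> p}"
  unfolding beta_def by (rule topology_generated_by_Basis) blast

text \<open>The generating sets are closed under binary intersection, so they form a base and not
  merely a subbase.\<close>

lemma openin_beta_basic_subset:
  assumes "openin beta T" "p \<in> T"
  obtains A where "A \<in> p" "{q. ultrafilter q \<and> A \<in> q} \<subseteq> T"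
proof -
  have p: "ultrafilter p"
    using openin_subset[OF assms(1)] assms(2) by (auto simp: topspace_beta)
  have "generate_topology_on (range (\<lambda>A. {p. ultrafilter p \<and> A \<in> p})) T"
    using assms(1) unfolding beta_def by (rule openin_topology_generated_by)
  then have "\<exists>A \<in> p. {q. ultrafilter q \<and> A \<in> q} \<subseteq> T"
    using assms(2)
  proof (induction rule: generate_topology_on.induct)
    case (Int S T)
    then obtain A B where "A \<in> p" "{q. ultrafilter q \<and> A \<in> q} \<subseteq> S" "B \<in> p" "{q. ultrafilter q \<and> B \<in> q} \<subseteq> T"
      by blast
    then show ?case
      using ultrafilter_Int[OF p] by (intro bexI[of _ "A \<inter> B"]) (auto simp: ultrafilter_Int_iff)
  qed blast+
  then show thesis
    using that by blast
qed

lemma closure_of_beta: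
  "p \<in> beta closure_of X \<longleftrightarrow> ultrafilter p \<and> (\<forall>A\<in>p. \<exists>q\<in>X. ultrafilter q \<and> A \<in> q)"
proof
  assume "p \<in> beta closure_of X"
  then have p: "ultrafilter p" "\<And>T. p \<in> T \<Longrightarrow> openin beta T \<Longrightarrow> \<exists>q\<in>X. q \<in> T"
    by (auto simp: in_closure_of topspace_beta)
  have "\<exists>q\<in>X. ultrafilter q \<and> A \<in> q" if "A \<in> p" for A
    using p(2)[OF _ openin_beta_basic[of A]] p(1) that by blast
  with p(1) show "ultrafilter p \<and> (\<forall>A\<in>p. \<exists>q\<in>X. ultrafilter q \<and> A \<in> q)"
    by blast
next
  assume p: "ultrafilter p \<and> (\<forall>A\<in>p. \<exists>q\<in>X. ultrafilter q \<and> A \<in> q)"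
  have "\<exists>q\<in>X. q \<in> T" if T: "p \<in> T" "openin beta T" for T
  proof -
    obtain A where "A \<in> p" "{q. ultrafilter q \<and> A \<in> q} \<subseteq> T"
      using openin_beta_basic_subset[OF T(2,1)] .
    then show ?thesis
      using p by blast
  qed
  then show "p \<in> beta closure_of X"
    using p by (simp add: in_closure_of topspace_beta Bex_def)
qed

lemma ultrafilter_principal_uf: "ultrafilter (principal_uf x)"
  unfolding ultrafilter_def principal_uf_def by blast

text \<open>All members of \<open>p\<close> meet \<open>C\<close> exactly if the complement of
  \<open>C\<close> is not a member, so the closure is the basic clopen set given by
  \<open>C\<close>.\<close>

lemma closure_of_principal_uf:
  "p \<in> beta closure_of (principal_uf ` C) \<longleftrightarrow> ultrafilter p \<and> C \<in> p"
proof (cases "ultrafilter p")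
  case True
  have "(\<exists>q \<in> principal_uf ` C. ultrafilter q \<and> A \<in> q) \<longleftrightarrow> A \<inter> C \<noteq> {}" for A
    by (auto simp: ultrafilter_principal_uf) (auto simp: principal_uf_def)
  then have "p \<in> beta closure_of (principal_uf ` C) \<longleftrightarrow> (\<forall>A\<in>p. A \<inter> C \<noteq> {})"
    using True by (simp add: closure_of_beta)
  also have "\<dots> \<longleftrightarrow> C \<in> p"
  proof
    assume *: "\<forall>A\<in>p. A \<inter> C \<noteq> {}"
    then have "- C \<notin> p"
      by blast
    then show "C \<in> p"
      by (simp add: ultrafilter_Compl[OF True])
  next
    assume C: "C \<in> p"
    have "A \<inter> C \<in> p" if "A \<in> p" for A
      by (rule ultrafilter_Int[OF True that C])
    then show "\<forall>A\<in>p. A \<inter> C \<noteq> {}"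
      using ultrafilter_empty[OF True] by fastforce
  qed
  finally show ?thesis
    using True by simp
qed (simp add: closure_of_beta)

lemma delta_iff: "p \<in> delta op \<longleftrightarrow> ultrafilter p \<and> (\<forall>x. phi op x \<in> p)"
  unfolding delta_def by (simp add: closure_of_principal_uf)

subsection \<open>J-sets\<close>

lemma sorted_list_of_set_1_n: "sorted_list_of_set {1..n} = [1..<Suc n]"
  by (metis atLeastLessThanSuc_atLeastAtMost sorted_list_of_set_range)

lemma ordered_prod_1_n: "ordered_prod op u {1..n} = list_prod op (map u [1..<Suc n])"
  unfolding ordered_prod_def sorted_list_of_set_1_n ..

lemma ordered_prod_cong:
  assumes "\<And>j. j \<in> {1..n} \<Longrightarrow> u j = v j"
  shows "ordered_prod op u {1..n} = ordered_prod op v {1..n}"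
proof -
  have "map u [1..<Suc n] = map v [1..<Suc n]"
    using assms by (intro map_cong) auto
  then show ?thesis
    by (simp only: ordered_prod_1_n)
qed

lemma left_quotient_iff: "y \<in> left_quotient op x A \<longleftrightarrow> op x y \<in> Some ` A"
  by (cases "op x y") (auto simp: left_quotient_def phi_def)

locale adequate_psg =
  fixes op :: "'a \<Rightarrow> 'a \<Rightarrow> 'a option"
  assumes adequate: "adequate_partial_semigroup op"
begin

abbreviation mult :: "'a option \<Rightarrow> 'a option \<Rightarrow> 'a option" (infixl "\<odot>" 70) where
  "u \<odot> v \<equiv> opt_mult op u v"

lemma mult_simps [simp]: "None \<odot> v = None" "u \<odot> None = None" "Some a \<odot> Some b = op a b"
  by (cases u; simp add: opt_mult_def)+

lemma mult_definedD: "u \<odot> v \<noteq> None \<Longrightarrow> u \<noteq> None \<and> v \<noteq> None"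
  by (cases u; cases v; simp)

lemma mult_assoc: "u \<odot> v \<odot> w = u \<odot> (v \<odot> w)"
proof (cases "u = None \<or> v = None \<or> w = None")
  case False
  then obtain a b c where "u = Some a" "v = Some b" "w = Some c"
    by auto
  then show ?thesis
    using adequate by (simp add: adequate_partial_semigroup_def partial_semigroup_def)
qed auto

lemma list_prod_snoc: "us \<noteq> [] \<Longrightarrow> list_prod op (us @ [v]) = list_prod op us \<odot> v"
  by (induction us rule: list_nonempty_induct) (auto simp: mult_assoc neq_Nil_conv)

text \<open>\<open>list_prod\<close> nests to the right, so splitting off the last factor uses
  associativity. Chains of sets grow at this end. For \<open>n = 0\<close> the equation can fail, as
  the empty product is \<open>None\<close>.\<close>

lemma ordered_prod_Suc:
  assumes "n \<ge> 1"
  shows "ordered_prod op u {1..Suc n} = ordered_prod op u {1..n} \<odot> u (Suc n)"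
proof -
  have "map u [1..<Suc (Suc n)] = map u [1..<Suc n] @ [u (Suc n)]"
    by simp
  then show ?thesis
    using assms by (simp only: ordered_prod_1_n) (simp add: list_prod_snoc del: upt_Suc)
qed

lemma sigma_nonempty:
  assumes "finite H"
  shows "sigma op H \<noteq> {}"
proof -
  have "insert x H \<in> Pf UNIV" for x
    using assms by (simp add: Pf_def)
  then have "sigma op (insert x H) \<noteq> {}" for x
    using adequate unfolding adequate_partial_semigroup_def by blast
  then show ?thesis
    by (auto simp: sigma_def)
qed

lemma adequate_sequence_eventually:
  assumes "adequate_sequence op f" "finite H"
  shows "\<exists>k. \<forall>t\<ge>k. f t \<in> sigma op H"
proof -
  \<comment> \<open>Inserting an element makes the set nonempty, as \<open>Pf\<close> requires, and
    can only shrink \<open>sigma\<close>. Below, adequacy is applied to one-element index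
    sets.\<close>
  have "insert x H \<in> Pf UNIV" for x
    using assms(2) by (simp add: Pf_def)
  then obtain k where k: "k \<ge> 1" "\<And>T. T \<in> Pf {1..} \<Longrightarrow> Min T \<ge> k \<Longrightarrow>
      \<exists>x \<in> sigma op (insert undefined H). ordered_prod op (\<lambda>t. Some (f t)) T = Some x"
    using assms(1) unfolding adequate_sequence_def by meson
  have "f t \<in> sigma op H" if "t \<ge> k" for t
    using k(1) k(2)[of "{t}"] that by (auto simp: Pf_def ordered_prod_def sigma_def)
  then show ?thesis
    by blast
qed

text \<open>A list \<open>[(a\<^sub>1, t\<^sub>1), \<dots>, (a\<^sub>m, t\<^sub>m)]\<close> together with a final element \<open>b\<close> stands for the values
  \<open>\<alpha>(F)\<close> and \<open>\<tau>(F)\<close> at some \<open>F\<close>.\<close>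

primrec eval :: "(nat \<Rightarrow> 'a) \<Rightarrow> ('a \<times> nat) list \<Rightarrow> 'a \<Rightarrow> 'a option" where
  "eval f [] b = Some b"
| "eval f (x # xs) b = Some (fst x) \<odot> (Some (f (snd x)) \<odot> eval f xs b)"

text \<open>The letters of the word are sequences. A colouring of the resulting products thus
  becomes a colouring of words, and the variable of a variable word can be replaced by each
  \<open>f\<close> in \<open>F\<close>.\<close>

primrec word_eval :: "('a \<times> nat) list \<Rightarrow> (nat \<Rightarrow> 'a) list \<Rightarrow> 'a \<Rightarrow> 'a option" where
  "word_eval xs [] b = Some b"
| "word_eval xs (g # w) b =
     Some (fst (hd xs)) \<odot> (Some (g (snd (hd xs))) \<odot> word_eval (tl xs) w b)"

text \<open>With \<open>l\<close> at the head of the list, a single sortedness condition says that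
  the indices increase and that all exceed \<open>l\<close>. Membership in the image under
  \<open>Some\<close> includes that the product is defined.\<close>

definition J_set :: "'a set \<Rightarrow> bool" where
  "J_set B \<longleftrightarrow> (\<forall>F \<in> Pf {f. adequate_sequence op f}. \<forall>l. \<exists>xs b.
     xs \<noteq> [] \<and> sorted_wrt (<) (l # map snd xs) \<and> (\<forall>f\<in>F. eval f xs b \<in> Some ` B))"

lemma eval_right_mult: "op b y = Some b' \<Longrightarrow> eval f xs b' = eval f xs b \<odot> Some y"
  by (induction xs) (simp_all add: mult_assoc)

text \<open>Associativity moves \<open>y\<close> next to \<open>b\<close>, which does not depend on
  \<open>f\<close>. So definedness for one sequence yields a new last element that serves all
  sequences.\<close>

lemma eval_right_mult_defined: "eval f xs b \<odot> Some y \<noteq> None \<Longrightarrow> op b y \<noteq> None"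
proof (induction xs)
  case (Cons x xs)
  have "eval f (x # xs) b \<odot> Some y = Some (fst x) \<odot> (Some (f (snd x)) \<odot> (eval f xs b \<odot> Some y))"
    by (simp add: mult_assoc)
  then have "eval f xs b \<odot> Some y \<noteq> None"
    using Cons.prems by (metis mult_definedD)
  then show ?case
    by (rule Cons.IH)
qed simp

text \<open>The factor \<open>c\<close> merges with the first coefficient, or with \<open>b\<close>
  if there is none. Neither depends on the sequence, so definedness for the single \<open>f0\<close>
  is enough.\<close>

lemma eval_left_mult:
  assumes "Some c \<odot> eval f0 xs b \<noteq> None"
  shows "\<exists>ys b'. map snd ys = map snd xs \<and> (\<forall>f. eval f ys b' = Some c \<odot> eval f xs b)"
proof (cases xs)
  case Nil
  then obtain b' where "op c b = Some b'"
    using assms by auto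
  then show ?thesis
    using Nil by (intro exI[of _ "[]"] exI[of _ b']) simp
next
  case (Cons x xs')
  have *: "Some c \<odot> eval f xs b = op c (fst x) \<odot> (Some (f (snd x)) \<odot> eval f xs' b)" for f
    using mult_assoc[of "Some c" "Some (fst x)"] Cons by simp
  then obtain a where "op c (fst x) = Some a"
    using assms by (cases "op c (fst x)") auto
  then show ?thesis
    using * Cons by (intro exI[of _ "(a, snd x) # xs'"] exI[of _ b]) simp
qed

text \<open>The constant letters of a variable word are absorbed into the neighbouring coefficients.\<close>

lemma word_eval_fill:
  assumes "F \<noteq> {}" "length xs = length v" "\<And>f. f \<in> F \<Longrightarrow> word_eval xs (fill f v) b \<noteq> None"
  shows "\<exists>ys b'. (\<forall>l. sorted_wrt (<) (l # map snd xs) \<longrightarrow> sorted_wrt (<) (l # map snd ys)) \<and>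
           (None \<in> set v \<longrightarrow> ys \<noteq> []) \<and> (\<forall>f\<in>F. eval f ys b' = word_eval xs (fill f v) b)"
  using assms(2,3)
proof (induction v arbitrary: xs)
  case Nil
  then show ?case
    by (intro exI[of _ "[]"] exI[of _ b]) (simp add: fill_def)
next
  case (Cons z v)
  then obtain a t xs' where xs: "xs = (a, t) # xs'"
    by (cases xs) auto
  have len: "length xs' = length v"
    using Cons.prems(1) xs by simp
  have tail: "word_eval xs' (fill f v) b \<noteq> None" if "f \<in> F" for f
  proof
    assume "word_eval xs' (fill f v) b = None"
    then have "word_eval xs (fill f (z # v)) b = None"
      by (simp add: xs fill_def)
    then show False
      using Cons.prems(2)[OF that] by contradiction
  qed
  obtain ys b' where ys: "\<And>l. sorted_wrt (<) (l # map snd xs') \<Longrightarrow> sorted_wrt (<) (l # map snd ys)"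
      "None \<in> set v \<Longrightarrow> ys \<noteq> []" "\<And>f. f \<in> F \<Longrightarrow> eval f ys b' = word_eval xs' (fill f v) b"
    using Cons.IH[OF len tail] by blast
  show ?case
  proof (cases z)
    case None
    \<comment> \<open>A variable position survives as an entry. The induction hypothesis holds for
      every lower bound and is used with \<open>t\<close>.\<close>
    have "sorted_wrt (<) (l # map snd ((a, t) # ys))" if "sorted_wrt (<) (l # map snd xs)" for l
    proof -
      have "l < t" "sorted_wrt (<) (t # map snd xs')"
        using that xs by auto
      then show ?thesis
        using ys(1)[of t] by auto
    qed
    moreover have "eval f ((a, t) # ys) b' = word_eval xs (fill f (z # v)) b" if "f \<in> F" for f
      using ys(3)[OF that] None xs by (simp add: fill_def)
    ultimately show ?thesis
      by blast
  next
    case (Some g)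
    \<comment> \<open>A constant letter \<open>g\<close> contributes an element that is the same for
      all \<open>f\<close>; it is multiplied onto the rest from the left and its index
      \<open>t\<close> disappears.\<close>
    have *: "word_eval xs (fill f (z # v)) b = op a (g t) \<odot> eval f ys b'" if "f \<in> F" for f
      using mult_assoc[of "Some a" "Some (g t)"] Some xs ys(3)[OF that] by (simp add: fill_def)
    obtain f0 where f0: "f0 \<in> F"
      using assms(1) by blast
    have "op a (g t) \<noteq> None"
      using mult_definedD Cons.prems(2)[OF f0] unfolding *[OF f0] by blast
    then obtain c where c: "op a (g t) = Some c"
      by blast
    then have "Some c \<odot> eval f0 ys b' \<noteq> None"
      using *[OF f0] Cons.prems(2)[OF f0] by simp
    then obtain zs b'' where zs: "map snd zs = map snd ys" "\<And>f. eval f zs b'' = Some c \<odot> eval f ys b'"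
      using eval_left_mult by metis
    have "sorted_wrt (<) (l # map snd zs)" if "sorted_wrt (<) (l # map snd xs)" for l
      unfolding zs(1) by (rule ys(1)) (use that xs in simp)
    moreover have "zs \<noteq> []" if "None \<in> set (z # v)"
      using that ys(2) zs(1) Some by auto
    moreover have "eval f zs b'' = word_eval xs (fill f (z # v)) b" if "f \<in> F" for f
      using zs(2) c *[OF that] by simp
    ultimately show ?thesis
      by blast
  qed
qed

text \<open>The factors are chosen from left to right: each coefficient and the final
  \<open>b\<close> by adequacy of \<open>op\<close>, each index so late that all sequences in
  \<open>F\<close> can follow the finitely many products formed so far. Hence \<open>H\<close> and
  \<open>l\<close> vary in the induction.\<close>

lemma word_eval_defined:
  assumes "finite F" "\<And>f. f \<in> F \<Longrightarrow> adequate_sequence op f" "finite H"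
  shows "\<exists>xs b. length xs = n \<and> sorted_wrt (<) (l # map snd xs) \<and>
           (\<forall>u\<in>H. \<forall>w\<in>words F n. Some u \<odot> word_eval xs w b \<noteq> None)"
  using assms(3)
proof (induction n arbitrary: H l)
  case 0
  then obtain b where "b \<in> sigma op H"
    using sigma_nonempty by blast
  then show ?case
    by (intro exI[of _ "[]"] exI[of _ b]) (auto simp: words_def sigma_def phi_def)
next
  case (Suc n)
  obtain a where a: "a \<in> sigma op H"
    using sigma_nonempty Suc.prems by blast
  define H1 where "H1 = (\<lambda>u. the (op u a)) ` H"
  have "\<forall>f\<in>F. \<exists>k. \<forall>t\<ge>k. f t \<in> sigma op H1"
    using adequate_sequence_eventually assms(2) Suc.prems by (simp add: H1_def)
  then obtain k where k: "\<And>f t. f \<in> F \<Longrightarrow> t \<ge> k f \<Longrightarrow> f t \<in> sigma op H1"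
    by metis
  \<comment> \<open>The sum bounds all thresholds \<open>k f\<close> at once; \<open>Suc l\<close>
    puts \<open>t\<close> beyond \<open>l\<close>.\<close>
  define t where "t = Suc l + (\<Sum>f\<in>F. k f)"
  have t: "f t \<in> sigma op H1" if "f \<in> F" for f
    using k[OF that] member_le_sum[OF that _ assms(1), of k] by (simp add: t_def)
  define H2 where "H2 = (\<lambda>(u, f). the (op u (f t))) ` (H1 \<times> F)"
  have "finite H2"
    using Suc.prems assms(1) by (simp add: H1_def H2_def)
  then obtain xs b where xs: "length xs = n" "sorted_wrt (<) (t # map snd xs)"
      "\<And>u w. u \<in> H2 \<Longrightarrow> w \<in> words F n \<Longrightarrow> Some u \<odot> word_eval xs w b \<noteq> None"
    using Suc.IH by metis
  have "Some u \<odot> word_eval ((a, t) # xs) w b \<noteq> None" if u: "u \<in> H" and w: "w \<in> words F (Suc n)" for u w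
  proof -
    obtain f w' where w': "w = f # w'" "f \<in> F" "w' \<in> words F n"
      using w by (cases w) (auto simp: words_def)
    obtain u1 where u1: "op u a = Some u1"
      using a u by (auto simp: sigma_def phi_def)
    then have "u1 \<in> H1"
      using u by (force simp: H1_def)
    then obtain u2 where u2: "op u1 (f t) = Some u2"
      using t[OF w'(2)] by (auto simp: sigma_def phi_def)
    then have "u2 \<in> H2"
      using \<open>u1 \<in> H1\<close> w'(2) by (force simp: H2_def)
    have "Some u \<odot> word_eval ((a, t) # xs) w b = Some u \<odot> Some a \<odot> Some (f t) \<odot> word_eval xs w' b"
      unfolding w' by (simp only: mult_assoc word_eval.simps list.sel fst_conv snd_conv)
    also have "\<dots> = Some u2 \<odot> word_eval xs w' b"
      using u1 u2 by simp
    finally show ?thesis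
      using xs(3)[OF \<open>u2 \<in> H2\<close> w'(3)] by simp
  qed
  moreover have "sorted_wrt (<) (l # map snd ((a, t) # xs))"
    using xs(2) by (auto simp: t_def)
  ultimately show ?case
    using xs(1) by (intro exI[of _ "(a, t) # xs"] exI[of _ b]) simp
qed

text \<open>Suppose that no member of \<C> is a J-set and pool the sequences and bounds that witness
  this. Colour a word over the pooled alphabet by a member of \<C> containing its value. A
  monochromatic variable word then refutes the failure of its own colour.\<close>

lemma J_set_partition:
  assumes "finite H" "finite \<C>" "sigma op H \<subseteq> \<Union>\<C>"
  shows "\<exists>C\<in>\<C>. J_set C"
proof (rule ccontr)
  assume "\<not> (\<exists>C\<in>\<C>. J_set C)"
  then have "\<forall>C\<in>\<C>. \<exists>F l. F \<in> Pf {f. adequate_sequence op f} \<and> (\<forall>xs b.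
     xs \<noteq> [] \<and> sorted_wrt (<) (l # map snd xs) \<longrightarrow> \<not> (\<forall>f\<in>F. eval f xs b \<in> Some ` C))"
    unfolding J_set_def by meson
  then obtain Fs ls where Fs: "\<And>C. C \<in> \<C> \<Longrightarrow> Fs C \<in> Pf {f. adequate_sequence op f}"
    and not_J: "\<And>C xs b. C \<in> \<C> \<Longrightarrow> xs \<noteq> [] \<Longrightarrow> sorted_wrt (<) (ls C # map snd xs) \<Longrightarrow>
      \<not> (\<forall>f\<in>Fs C. eval f xs b \<in> Some ` C)"
    by metis
  have "\<C> \<noteq> {}"
    using assms(3) sigma_nonempty[OF assms(1)] by blast
  define F where "F = \<Union>(Fs ` \<C>)"
  define l where "l = (\<Sum>C\<in>\<C>. ls C)"
  have F: "finite F" "F \<noteq> {}" "\<And>f. f \<in> F \<Longrightarrow> adequate_sequence op f"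
    using Fs \<open>\<C> \<noteq> {}\<close> assms(2) by (auto simp: F_def Pf_def)
  obtain n where n: "\<And>c. c ` words F n \<subseteq> \<C> \<Longrightarrow>
           (\<exists>v \<in> variable_words F n. \<exists>C \<in> \<C>. \<forall>f\<in>F. c (fill f v) = C)"
    using hales_jewett[OF F(1,2) assms(2)] by metis
  obtain xs b where xs: "length xs = n" "sorted_wrt (<) (l # map snd xs)"
    and xs_defined: "\<forall>u \<in> insert undefined H. \<forall>w \<in> words F n. Some u \<odot> word_eval xs w b \<noteq> None"
    \<comment> \<open>A left factor from \<open>H\<close> being allowed means that the value lies in
      \<open>sigma op H\<close>. Inserting \<open>undefined\<close> ensures that the value itself is
      defined even if \<open>H\<close> is empty.\<close>
    using word_eval_defined[OF F(1,3), of "insert undefined H" n l] assms(1) by blast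
  have defined: "Some u \<odot> word_eval xs w b \<noteq> None" if "u \<in> insert undefined H" "w \<in> words F n" for u w
    using xs_defined that by blast
  have "\<exists>C\<in>\<C>. word_eval xs w b \<in> Some ` C" if w: "w \<in> words F n" for w
  proof -
    obtain x where x: "word_eval xs w b = Some x"
      using defined[OF _ w, of undefined] by (cases "word_eval xs w b") auto
    then have "x \<in> sigma op H"
      using defined[OF _ w] by (auto simp: sigma_def phi_def)
    then show ?thesis
      using assms(3) x by blast
  qed
  then obtain c where c: "\<And>w. w \<in> words F n \<Longrightarrow> c w \<in> \<C> \<and> word_eval xs w b \<in> Some ` c w"
    by metis
  then obtain v C where v: "v \<in> variable_words F n" and C: "C \<in> \<C>" "\<And>f. f \<in> F \<Longrightarrow> c (fill f v) = C"
    using n[of c] by blast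
  have in_C: "word_eval xs (fill f v) b \<in> Some ` C" if "f \<in> F" for f
    using c[OF fill_in_words[OF v order_refl that]] C(2)[OF that] by simp
  have "length xs = length v" "None \<in> set v"
    using v xs(1) by (auto simp: variable_words_def words_def)
  moreover have "word_eval xs (fill f v) b \<noteq> None" if "f \<in> F" for f
    using in_C[OF that] by auto
  ultimately obtain ys b' where ys: "sorted_wrt (<) (l # map snd ys)" "ys \<noteq> []"
      "\<And>f. f \<in> F \<Longrightarrow> eval f ys b' = word_eval xs (fill f v) b"
    using word_eval_fill[OF F(2), of xs v b] xs(2) by metis
  have "ls C \<le> l"
    using member_le_sum[OF C(1) _ assms(2), of ls] by (simp add: l_def)
  then have "sorted_wrt (<) (ls C # map snd ys)"
    using ys(1) by auto
  moreover have "\<forall>f\<in>Fs C. eval f ys b' \<in> Some ` C"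
  proof
    fix f assume "f \<in> Fs C"
    then have "f \<in> F"
      using C(1) by (auto simp: F_def)
    then show "eval f ys b' \<in> Some ` C"
      using ys(3) in_C by simp
  qed
  ultimately show False
    using not_J[OF C(1) ys(2)] by blast
qed

text \<open>Take the sets \<open>phi op x\<close> together with the complements of all sets that are
  not J-sets. An empty finite intersection would cover some \<open>sigma op H\<close> by finitely
  many sets that are not J-sets, so an ultrafilter contains the whole family.\<close>

lemma ex_delta_J_set: "\<exists>p\<in>delta op. \<forall>B\<in>p. J_set B"
proof -
  let ?N = "{C. \<not> J_set C}"
  have "\<Inter>X \<noteq> {}" if "finite X" "X \<subseteq> range (phi op) \<union> uminus ` ?N" for X
  proof
    assume empty: "\<Inter>X = {}"
    have fin: "finite (X \<inter> Y)" for Y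
      using that(1) by simp
    obtain H where H: "finite H" "X \<inter> range (phi op) = phi op ` H"
      using finite_subset_image[OF fin Int_lower2, where f = "phi op" and A = UNIV] by metis
    obtain \<C> where \<C>: "finite \<C>" "\<C> \<subseteq> ?N" "X \<inter> uminus ` ?N = uminus ` \<C>"
      using finite_subset_image[OF fin Int_lower2, where f = uminus and A = ?N] by metis
    have "X = phi op ` H \<union> uminus ` \<C>"
      using that(2) unfolding H(2)[symmetric] \<C>(3)[symmetric] by blast
    moreover have "\<Inter>(phi op ` H \<union> uminus ` \<C>) = sigma op H - \<Union>\<C>"
      by (auto simp: sigma_def)
    ultimately have "sigma op H \<subseteq> \<Union>\<C>"
      using empty by simp
    then obtain C where "C \<in> \<C>" "J_set C"
      using J_set_partition[OF H(1) \<C>(1)] by blast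
    then show False
      using \<C>(2) by auto
  qed
  then obtain p where p: "ultrafilter p" "range (phi op) \<union> uminus ` ?N \<subseteq> p"
    by (rule ultrafilter_extension)
  have "J_set B" if "B \<in> p" for B
  proof (rule ccontr)
    assume "\<not> J_set B"
    then have "- B \<in> p"
      using p(2) by auto
    then show False
      using that ultrafilter_Compl[OF p(1), of B] by simp
  qed
  moreover have "p \<in> delta op"
    using p by (simp add: delta_iff image_subset_iff)
  ultimately show ?thesis
    by blast
qed

subsection \<open>The ideal of ultrafilters of J-sets\<close>

lemma left_quotient_mono: "A \<subseteq> B \<Longrightarrow> left_quotient op x A \<subseteq> left_quotient op x B"
  by (auto simp: left_quotient_def)

lemma left_quotient_Int: "left_quotient op x (A \<inter> B) = left_quotient op x A \<inter> left_quotient op x B"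
  by (auto simp: left_quotient_def)

lemma left_quotient_Compl: "left_quotient op x (- A) = phi op x - left_quotient op x A"
  by (auto simp: left_quotient_def)

lemma left_quotient_left_quotient:
  assumes "op x y = Some z"
  shows "left_quotient op y (left_quotient op x A) = left_quotient op z A"
proof -
  have *: "op z w = Some x \<odot> op y w" for w
    using mult_assoc[of "Some x" "Some y" "Some w"] assms by simp
  then have "w \<in> left_quotient op y (left_quotient op x A) \<longleftrightarrow> w \<in> left_quotient op z A" for w
    using *[of w] by (cases "op y w") (auto simp: left_quotient_iff)
  then show ?thesis
    by blast
qed

lemma uf_mult_iff: "A \<in> uf_mult op p q \<longleftrightarrow> {x. left_quotient op x A \<in> q} \<in> p"
  by (simp add: uf_mult_def)

text \<open>Membership of \<open>q\<close> in \<delta>S matters for complements: quotients of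
  complementary sets are complementary only within \<open>phi op x\<close>, which belongs to
  \<open>q\<close>.\<close>

lemma ultrafilter_uf_mult:
  assumes p: "ultrafilter p" and q: "q \<in> delta op"
  shows "ultrafilter (uf_mult op p q)"
proof -
  have q': "ultrafilter q" and phi: "\<And>x. phi op x \<in> q"
    using q by (auto simp: delta_iff)
  have UNIV: "left_quotient op x UNIV = phi op x" for x
    by (auto simp: left_quotient_def)
  have Compl: "left_quotient op x (- A) \<in> q \<longleftrightarrow> left_quotient op x A \<notin> q" for x A
    unfolding left_quotient_Compl Diff_eq
    by (simp add: ultrafilter_Int_iff[OF q'] ultrafilter_Compl[OF q'] phi)
  show ?thesis
    unfolding ultrafilter_def uf_mult_iff
  proof (intro conjI allI impI)
    show "{x. left_quotient op x UNIV \<in> q} \<in> p"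
      using ultrafilter_UNIV[OF p] by (simp add: UNIV phi)
    show "{x. left_quotient op x {} \<in> q} \<notin> p"
      using ultrafilter_empty[OF p] ultrafilter_empty[OF q'] by (simp add: left_quotient_def)
    show "{x. left_quotient op x (A \<inter> B) \<in> q} \<in> p"
      if "{x. left_quotient op x A \<in> q} \<in> p \<and> {x. left_quotient op x B \<in> q} \<in> p" for A B
      using that by (simp add: left_quotient_Int ultrafilter_Int_iff[OF q'] Collect_conj_eq
          ultrafilter_Int_iff[OF p])
    show "{x. left_quotient op x B \<in> q} \<in> p"
      if "{x. left_quotient op x A \<in> q} \<in> p \<and> A \<subseteq> B" for A B
    proof (rule ultrafilter_mono[OF p])
      show "{x. left_quotient op x A \<in> q} \<subseteq> {x. left_quotient op x B \<in> q}"
        using ultrafilter_mono[OF q' _ left_quotient_mono] that by blast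
    qed (use that in blast)
    show "{x. left_quotient op x A \<in> q} \<in> p \<or> {x. left_quotient op x (- A) \<in> q} \<in> p" for A
      unfolding Compl using ultrafilter_Compl[OF p, of "{x. left_quotient op x A \<in> q}"]
      by (simp add: Collect_neg_eq)
  qed
qed

lemma uf_mult_in_delta:
  assumes p: "p \<in> delta op" and q: "q \<in> delta op"
  shows "uf_mult op p q \<in> delta op"
proof -
  have p': "ultrafilter p" "\<And>x. phi op x \<in> p" and q': "ultrafilter q" "\<And>x. phi op x \<in> q"
    using p q by (auto simp: delta_iff)
  have "phi op s \<in> uf_mult op p q" for s
    unfolding uf_mult_iff
  proof (rule ultrafilter_mono[OF p'(1) p'(2)[of s]], rule subsetI, rule CollectI)
    fix x assume "x \<in> phi op s"
    then obtain z where z: "op s x = Some z"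
      by (auto simp: phi_def)
    \<comment> \<open>Writing both domains as quotients of \<open>UNIV\<close> shows that the
      quotient of \<open>phi op s\<close> by \<open>x\<close> is \<open>phi op z\<close>, a member
      of \<open>q\<close>.\<close>
    have "phi op s = left_quotient op s UNIV" "phi op z = left_quotient op z UNIV"
      by (auto simp: left_quotient_def)
    then show "left_quotient op x (phi op s) \<in> q"
      using left_quotient_left_quotient[OF z, of UNIV] q'(2)[of z] by simp
  qed
  then show ?thesis
    using ultrafilter_uf_mult[OF p'(1) q] by (simp add: delta_iff)
qed

lemma delta_ideal_J_set: "delta_ideal op {p \<in> delta op. \<forall>B\<in>p. J_set B}"
proof -
  have right: "J_set A" if p: "p \<in> delta op" and q: "\<And>B. B \<in> q \<Longrightarrow> J_set B" "q \<in> delta op"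
    and A: "A \<in> uf_mult op p q" for p q A
  proof -
    \<comment> \<open>One suitable \<open>x\<close> suffices: the quotient of \<open>A\<close> by it
      is a J-set, and \<open>x\<close> is then absorbed on the left.\<close>
    have "{x. left_quotient op x A \<in> q} \<noteq> {}"
      using A p ultrafilter_empty[of p] by (metis delta_iff uf_mult_iff)
    then obtain x where x: "left_quotient op x A \<in> q"
      by blast
    show ?thesis
      unfolding J_set_def
    proof (intro ballI allI)
      fix F l assume F: "F \<in> Pf {f. adequate_sequence op f}"
      obtain xs b where xs: "xs \<noteq> []" "sorted_wrt (<) (l # map snd xs)"
          "\<And>f. f \<in> F \<Longrightarrow> eval f xs b \<in> Some ` left_quotient op x A"
        using q(1)[OF x] F unfolding J_set_def by meson
      have in_A: "Some x \<odot> eval f xs b \<in> Some ` A" if "f \<in> F" for f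
        using xs(3)[OF that] by (auto simp: left_quotient_iff)
      obtain f0 where f0: "f0 \<in> F"
        using F by (auto simp: Pf_def)
      have "Some x \<odot> eval f0 xs b \<noteq> None"
        using in_A[OF f0] by auto
      then obtain ys b' where ys: "map snd ys = map snd xs" "\<And>f. eval f ys b' = Some x \<odot> eval f xs b"
        using eval_left_mult by metis
      have "ys \<noteq> []"
        using ys(1) xs(1) by auto
      then show "\<exists>xs b. xs \<noteq> [] \<and> sorted_wrt (<) (l # map snd xs) \<and> (\<forall>f\<in>F. eval f xs b \<in> Some ` A)"
        using xs(2) in_A ys by (intro exI[of _ ys] exI[of _ b']) simp
    qed
  qed
  have left: "J_set A" if p: "p \<in> delta op" and q: "\<And>B. B \<in> q \<Longrightarrow> J_set B"
    and A: "A \<in> uf_mult op q p" for p q A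
    unfolding J_set_def
  proof (intro ballI allI)
    have p': "ultrafilter p"
      using p by (simp add: delta_iff)
    fix F l assume F: "F \<in> Pf {f. adequate_sequence op f}"
    then have "finite F" "F \<noteq> {}"
      by (auto simp: Pf_def)
    obtain xs b where xs: "xs \<noteq> []" "sorted_wrt (<) (l # map snd xs)"
        "\<And>f. f \<in> F \<Longrightarrow> eval f xs b \<in> Some ` {x. left_quotient op x A \<in> p}"
      using q[OF A[unfolded uf_mult_iff]] F unfolding J_set_def by meson
    \<comment> \<open>The finitely many values for \<open>f\<close> in \<open>F\<close> have
      quotients in \<open>p\<close>, so a common \<open>y\<close> multiplies all of them into
      \<open>A\<close> from the right.\<close>
    have "left_quotient op (the (eval f xs b)) A \<in> p" if "f \<in> F" for f
      using xs(3)[OF that] by auto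
    then have "(\<Inter>f\<in>F. left_quotient op (the (eval f xs b)) A) \<in> p"
      by (rule ultrafilter_INT[OF p' \<open>finite F\<close>])
    then have "(\<Inter>f\<in>F. left_quotient op (the (eval f xs b)) A) \<noteq> {}"
      using ultrafilter_empty[OF p'] by metis
    then obtain y where y: "\<And>f. f \<in> F \<Longrightarrow> y \<in> left_quotient op (the (eval f xs b)) A"
      by blast
    have in_A: "eval f xs b \<odot> Some y \<in> Some ` A" if "f \<in> F" for f
    proof -
      obtain z where "eval f xs b = Some z"
        using xs(3)[OF \<open>f \<in> F\<close>] by blast
      then show ?thesis
        using y[OF that] by (simp add: left_quotient_iff)
    qed
    obtain f0 where f0: "f0 \<in> F"
      using \<open>F \<noteq> {}\<close> by blast
    have "eval f0 xs b \<odot> Some y \<noteq> None"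
      using in_A[OF f0] by auto
    then obtain b' where "op b y = Some b'"
      using eval_right_mult_defined by blast
    then show "\<exists>xs b. xs \<noteq> [] \<and> sorted_wrt (<) (l # map snd xs) \<and> (\<forall>f\<in>F. eval f xs b \<in> Some ` A)"
      using xs(1,2) in_A eval_right_mult by (intro exI[of _ xs] exI[of _ b']) simp
  qed
  show ?thesis
    unfolding delta_ideal_def
  proof (intro conjI ballI)
    show "{p \<in> delta op. \<forall>B\<in>p. J_set B} \<noteq> {}"
      using ex_delta_J_set by blast
  next
    fix p q assume p: "p \<in> delta op" and "q \<in> {p \<in> delta op. \<forall>B\<in>p. J_set B}"
    then have q: "q \<in> delta op" "\<And>B. B \<in> q \<Longrightarrow> J_set B"
      by simp_all
    show "uf_mult op p q \<in> {p \<in> delta op. \<forall>B\<in>p. J_set B}"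
      using uf_mult_in_delta[OF p q(1)] right[OF p q(2,1)] by simp
    show "uf_mult op q p \<in> {p \<in> delta op. \<forall>B\<in>p. J_set B}"
      using uf_mult_in_delta[OF q(1) p] left[OF p q(2)] by simp
  qed blast
qed

text \<open>Every member of a point of the closure is a member of some ultrafilter in K(\<delta>S),
  and the ideal of the preceding lemma contains K(\<delta>S).\<close>

lemma J_set_of_closure_K_delta:
  assumes "p \<in> beta closure_of (K_delta op)" "B \<in> p"
  shows "J_set B"
proof -
  obtain q where "q \<in> K_delta op" "B \<in> q"
    using assms by (auto simp: closure_of_beta)
  then show ?thesis
    using delta_ideal_J_set unfolding K_delta_def by blast
qed

lemma idempotent_star:
  assumes p: "ultrafilter p" and idem: "uf_mult op p p = p" and A: "A \<in> p"
  defines "star \<equiv> {x \<in> A. left_quotient op x A \<in> p}"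
  shows "star \<in> p" "x \<in> star \<Longrightarrow> left_quotient op x star \<in> p"
proof -
  have shift: "{x. left_quotient op x B \<in> p} \<in> p" if "B \<in> p" for B
    using that idem uf_mult_iff by metis
  have "A \<inter> {x. left_quotient op x A \<in> p} \<in> p"
    using ultrafilter_Int[OF p A shift[OF A]] .
  then show "star \<in> p"
    by (simp add: star_def Collect_conj_eq)
  assume x: "x \<in> star"
  let ?B = "left_quotient op x A"
  have B: "?B \<in> p"
    using x by (simp add: star_def)
  show "left_quotient op x star \<in> p"
  \<comment> \<open>Idempotence is applied a second time, to the quotient \<open>?B\<close>. For
    \<open>y\<close> in the intersection, the quotient of \<open>?B\<close> by \<open>y\<close> is
    that of \<open>A\<close> by the product of \<open>x\<close> and \<open>y\<close>, so this
    product is in \<open>star\<close>.\<close>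
  proof (rule ultrafilter_mono[OF p ultrafilter_Int[OF p B shift[OF B]]], rule subsetI)
    fix y assume y: "y \<in> ?B \<inter> {y. left_quotient op y ?B \<in> p}"
    then obtain z where z: "op x y = Some z" "z \<in> A"
      by (auto simp: left_quotient_iff)
    then have "left_quotient op z A \<in> p"
      using y left_quotient_left_quotient[OF z(1)] by simp
    then show "y \<in> left_quotient op x star"
      using z by (simp add: left_quotient_iff star_def)
  qed
qed

subsection \<open>Recursion along chains\<close>

text \<open>The theorem pairs each coefficient with a value of \<open>f\<close> and puts the last
  coefficient after the whole product, while \<open>eval\<close> nests to the right; associativity
  reconciles them. The shift \<open>j - 1\<close> turns indices from 1 into list positions from
  0.\<close>

lemma ordered_prod_eval:
  assumes "xs \<noteq> []"
  shows "ordered_prod op (\<lambda>j. op (fst (xs ! (j - 1))) (f (snd (xs ! (j - 1))))) {1..length xs} \<odot> Some b =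
    eval f xs b"
proof -
  have "map (\<lambda>j. op (fst (xs ! (j - 1))) (f (snd (xs ! (j - 1))))) [1..<Suc (length xs)] =
      map (\<lambda>x. op (fst x) (f (snd x))) xs"
    by (rule nth_equalityI) (simp_all del: upt_Suc)
  moreover have "list_prod op (map (\<lambda>x. op (fst x) (f (snd x))) xs) \<odot> Some b = eval f xs b"
    using assms
  proof (induction xs rule: list_nonempty_induct)
    case (single x)
    then show ?case
      using mult_assoc[of "Some (fst x)" "Some (f (snd x))"] by simp
  next
    case (cons x xs)
    have "list_prod op (map (\<lambda>x. op (fst x) (f (snd x))) (x # xs)) =
        op (fst x) (f (snd x)) \<odot> list_prod op (map (\<lambda>x. op (fst x) (f (snd x))) xs)"
      using cons.hyps by (cases xs) simp_all
    then show ?case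
      using cons.IH mult_assoc[of "Some (fst x)" "Some (f (snd x))"] by (simp add: mult_assoc)
  qed
  ultimately show ?thesis
    by (simp only: ordered_prod_1_n)
qed

text \<open>In a function \<open>D\<close> on finite sets of sequences, \<open>fst (D F)\<close> encodes \<open>\<alpha>(F)\<close> and \<open>\<tau>(F)\<close>, and \<open>snd (D F)\<close>
  collects the products along all chains that end in \<open>F\<close>.\<close>

definition admissible ::
    "'a set \<Rightarrow> ((nat \<Rightarrow> 'a) set \<Rightarrow> (('a \<times> nat) list \<times> 'a) \<times> 'a option set) \<Rightarrow> (nat \<Rightarrow> 'a) set \<Rightarrow>
      (('a \<times> nat) list \<times> 'a) \<times> 'a option set \<Rightarrow> bool" where
  "admissible B D F r \<longleftrightarrow>
    fst (fst r) \<noteq> [] \<and> sorted_wrt (<) (0 # map snd (fst (fst r))) \<and>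
    (\<forall>G. G \<subset> F \<and> G \<noteq> {} \<longrightarrow>
       (\<forall>s \<in> snd ` set (fst (fst (D G))). \<forall>t \<in> snd ` set (fst (fst r)). s < t)) \<and>
    snd r = (\<lambda>f. eval f (fst (fst r)) (snd (fst r))) ` F \<union>
      (\<lambda>(y, f). y \<odot> eval f (fst (fst r)) (snd (fst r))) ` ((\<Union>G \<in> {G. G \<subset> F \<and> G \<noteq> {}}. snd (D G)) \<times> F) \<and>
    finite (snd r) \<and> snd r \<subseteq> Some ` B"

lemma admissibleD:
  assumes "admissible B D F (D F)"
  shows "fst (fst (D F)) \<noteq> []"
    and "sorted_wrt (<) (0 # map snd (fst (fst (D F))))"
    and "G \<subset> F \<Longrightarrow> G \<noteq> {} \<Longrightarrow> s \<in> snd ` set (fst (fst (D G))) \<Longrightarrow>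
         t \<in> snd ` set (fst (fst (D F))) \<Longrightarrow> s < t"
    and "f \<in> F \<Longrightarrow> eval f (fst (fst (D F))) (snd (fst (D F))) \<in> snd (D F)"
    and "G \<subset> F \<Longrightarrow> G \<noteq> {} \<Longrightarrow> y \<in> snd (D G) \<Longrightarrow> f \<in> F \<Longrightarrow>
         y \<odot> eval f (fst (fst (D F))) (snd (fst (D F))) \<in> snd (D F)"
    and "finite (snd (D F))"
    and "snd (D F) \<subseteq> Some ` B"
proof -
  note * = assms[unfolded admissible_def]
  show "fst (fst (D F)) \<noteq> []" "sorted_wrt (<) (0 # map snd (fst (fst (D F))))"
      "finite (snd (D F))" "snd (D F) \<subseteq> Some ` B"
      "G \<subset> F \<Longrightarrow> G \<noteq> {} \<Longrightarrow> s \<in> snd ` set (fst (fst (D G))) \<Longrightarrow>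
         t \<in> snd ` set (fst (fst (D F))) \<Longrightarrow> s < t"
    using * by blast+
  let ?e = "\<lambda>f. eval f (fst (fst (D F))) (snd (fst (D F)))"
  have snd: "snd (D F) = ?e ` F \<union>
      (\<lambda>(y, f). y \<odot> ?e f) ` ((\<Union>G \<in> {G. G \<subset> F \<and> G \<noteq> {}}. snd (D G)) \<times> F)"
    using * by blast
  show "?e f \<in> snd (D F)" if "f \<in> F"
    by (subst snd) (use that in blast)
  show "y \<odot> ?e f \<in> snd (D F)" if "G \<subset> F" "G \<noteq> {}" "y \<in> snd (D G)" "f \<in> F"
  proof -
    have "(y, f) \<in> (\<Union>G \<in> {G. G \<subset> F \<and> G \<noteq> {}}. snd (D G)) \<times> F"
      using that by blast
    then have "(case (y, f) of (y, f) \<Rightarrow> y \<odot> ?e f) \<in>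
        (\<lambda>(y, f). y \<odot> ?e f) ` ((\<Union>G \<in> {G. G \<subset> F \<and> G \<noteq> {}}. snd (D G)) \<times> F)"
      by (rule imageI)
    then show ?thesis
      by (subst snd) simp
  qed
qed

text \<open>Well-founded choice along proper inclusion of finite sets. The invariant that all chain
  products lie in \<open>star\<close> lets the next value be chosen in finitely many quotients of
  \<open>star\<close> at once.\<close>

lemma ex_admissible:
  assumes p: "ultrafilter p" and J: "\<And>B. B \<in> p \<Longrightarrow> J_set B"
    and star: "star \<in> p" "\<And>x. x \<in> star \<Longrightarrow> left_quotient op x star \<in> p"
  shows "\<exists>D. \<forall>F \<in> Pf {f. adequate_sequence op f}. admissible star D F (D F)"
proof -
  define \<F> where "\<F> = {f. adequate_sequence op f}"
  \<comment> \<open>The choice principle asks for a value at every set; outside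
    \<open>Pf \<F>\<close> any value is accepted.\<close>
  define P where "P D F r \<longleftrightarrow> (F \<in> Pf \<F> \<longrightarrow> admissible star D F r)" for D F r
  have "\<exists>D. \<forall>F. P D F (D F)"
  proof (rule dependent_wf_choice[OF wf_finite_psubset])
    fix D E :: "(nat \<Rightarrow> 'a) set \<Rightarrow> (('a \<times> nat) list \<times> 'a) \<times> 'a option set" and F r
    assume eq: "\<And>G. (G, F) \<in> finite_psubset \<Longrightarrow> D G = E G"
    show "P D F r = P E F r"
    proof (cases "F \<in> Pf \<F>")
      case True
      then have "D G = E G" if "G \<subset> F" for G
        using eq that by (simp add: Pf_def)
      then show ?thesis
        by (simp add: P_def admissible_def cong: conj_cong)
    qed (simp add: P_def)
  next
    fix F :: "(nat \<Rightarrow> 'a) set" and D :: "(nat \<Rightarrow> 'a) set \<Rightarrow> (('a \<times> nat) list \<times> 'a) \<times> 'a option set"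
    assume IH: "\<And>G. (G, F) \<in> finite_psubset \<Longrightarrow> P D G (D G)"
    show "\<exists>r. P D F r"
    proof (cases "F \<in> Pf \<F>")
      case True
      then have F: "finite F"
        by (simp add: Pf_def)
      define \<G> where "\<G> = {G. G \<subset> F \<and> G \<noteq> {}}"
      have "finite \<G>"
        using F by (auto simp: \<G>_def intro: finite_subset[of _ "Pow F"])
      have \<G>: "finite (snd (D G))" "snd (D G) \<subseteq> Some ` star" if "G \<in> \<G>" for G
      proof -
        have "G \<in> Pf \<F>" "(G, F) \<in> finite_psubset"
          using that True F finite_subset by (auto simp: \<G>_def Pf_def)
        then show "finite (snd (D G))" "snd (D G) \<subseteq> Some ` star"
          using admissibleD(6,7)[of star D G] IH[of G] by (simp_all add: P_def)
      qed
      define W where "W = (\<Union>G\<in>\<G>. snd (D G))"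
      have W: "finite W" "W \<subseteq> Some ` star"
        using \<G> \<open>finite \<G>\<close> by (auto simp: W_def)
      define T where "T = (\<Union>G\<in>\<G>. snd ` set (fst (fst (D G))))"
      have T: "finite T"
        using \<open>finite \<G>\<close> by (simp add: T_def)
      \<comment> \<open>A value in \<open>B\<close> starts a new chain inside \<open>star\<close>
        and also prolongs every earlier chain inside \<open>star\<close>.\<close>
      define B where "B = star \<inter> (\<Inter>y\<in>W. left_quotient op (the y) star)"
      have "B \<in> p"
        unfolding B_def using W(2) star(2)
        by (intro ultrafilter_Int[OF p star(1)] ultrafilter_INT[OF p W(1)]) auto
      \<comment> \<open>The new indices exceed all those used at proper nonempty subsets of
        \<open>F\<close>. Inserting 0 makes the maximum meaningful for empty \<open>T\<close> and
        keeps the indices positive.\<close>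
      then obtain xs b where xs: "xs \<noteq> []" "sorted_wrt (<) (Max (insert 0 T) # map snd xs)"
          "\<And>f. f \<in> F \<Longrightarrow> eval f xs b \<in> Some ` B"
        using J True unfolding J_set_def \<F>_def by meson
      define V where "V = (\<lambda>f. eval f xs b) ` F \<union> (\<lambda>(y, f). y \<odot> eval f xs b) ` (W \<times> F)"
      have "finite V"
        using F W(1) by (simp add: V_def)
      have "y \<odot> eval f xs b \<in> Some ` star" if "y \<in> W" "f \<in> F" for y f
      proof -
        obtain z where z: "eval f xs b = Some z" "z \<in> B"
          using xs(3)[OF \<open>f \<in> F\<close>] by blast
        then have "op (the y) z \<in> Some ` star"
          using that(1) by (auto simp: B_def left_quotient_iff)
        moreover have "y = Some (the y)"
          using W(2) that(1) by auto
        ultimately show ?thesis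
          using z(1) mult_simps(3)[of "the y" z] by simp
      qed
      moreover have "eval f xs b \<in> Some ` star" if "f \<in> F" for f
        using xs(3)[OF that] by (auto simp: B_def)
      ultimately have "V \<subseteq> Some ` star"
        by (auto simp: V_def)
      have le_Max: "s \<le> Max (insert 0 T)" if "s \<in> insert 0 T" for s
        using T that by (intro Max_ge) auto
      have gt: "s < t" if "s \<in> insert 0 T" "t \<in> snd ` set xs" for s t
        using le_less_trans[OF le_Max[OF that(1)]] xs(2) that(2) by auto
      have "sorted_wrt (<) (0 # map snd xs)"
        using xs(2) gt by auto
      moreover have "s < t" if "G \<subset> F \<and> G \<noteq> {}" "s \<in> snd ` set (fst (fst (D G)))" "t \<in> snd ` set xs" for G s t
        using gt[OF _ that(3), of s] that(1,2) unfolding T_def \<G>_def by blast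
      ultimately have "P D F ((xs, b), V)"
        unfolding P_def admissible_def fst_conv snd_conv \<G>_def[symmetric] W_def[symmetric] V_def[symmetric]
        using xs(1) \<open>finite V\<close> \<open>V \<subseteq> Some ` star\<close> by blast
      then show ?thesis
        by blast
    qed (simp add: P_def)
  qed
  then show ?thesis
    unfolding P_def \<F>_def by blast
qed
end

section \<open>Reading off m, \<alpha> and \<tau> from the recursion\<close>

theorem theorem5p7:
  fixes op :: "'a \<Rightarrow> 'a \<Rightarrow> 'a option"
    and A :: "'a set"
    and \<F> :: "(nat \<Rightarrow> 'a) set"
  assumes "adequate_partial_semigroup op"
    and "quasi_central op A"
    and "\<F> = {f. adequate_sequence op f}"
  shows "\<exists>m \<in> Pf \<F> \<rightarrow>\<^sub>E {1..}.
         \<exists>\<alpha> \<in> (\<Pi>\<^sub>E F\<in>Pf \<F>. {1..m F + 1} \<rightarrow>\<^sub>E (UNIV :: 'a set)).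
         \<exists>\<tau> \<in> (\<Pi>\<^sub>E F\<in>Pf \<F>. increasing_tuples (m F)).
           (\<forall>F \<in> Pf \<F>. \<forall>G \<in> Pf \<F>. F \<subset> G \<longrightarrow> \<tau> F (m F) < \<tau> G 1) \<and>
           (\<forall>n \<ge> 1. \<forall>(G :: nat \<Rightarrow> (nat \<Rightarrow> 'a) set) (f :: nat \<Rightarrow> nat \<Rightarrow> 'a).
              (\<forall>i \<in> {1..n}. G i \<in> Pf \<F>) \<and>
              (\<forall>i \<in> {1..<n}. G i \<subset> G (i + 1)) \<and>
              (\<forall>i \<in> {1..n}. f i \<in> G i) \<longrightarrow>
              (\<exists>x \<in> A.
                 ordered_prod op
                   (\<lambda>i. opt_mult op
                      (ordered_prod op
                         (\<lambda>j. op (\<alpha> (G i) j) (f i (\<tau> (G i) j)))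
                         {1..m (G i)})
                      (Some (\<alpha> (G i) (m (G i) + 1))))
                   {1..n} = Some x))"
proof -
  interpret adequate_psg op
    using assms(1) by unfold_locales
  obtain p where p: "p \<in> beta closure_of (K_delta op)" "uf_mult op p p = p" "A \<in> p"
    using assms(2) by (auto simp: quasi_central_def)
  then have "ultrafilter p"
    by (simp add: closure_of_beta)
  define star where "star = {x \<in> A. left_quotient op x A \<in> p}"
  have star: "star \<in> p" "\<And>x. x \<in> star \<Longrightarrow> left_quotient op x star \<in> p"
    using idempotent_star[OF \<open>ultrafilter p\<close> p(2,3)] unfolding star_def by blast+
  obtain D where "\<forall>F\<in>Pf \<F>. admissible star D F (D F)"
    using ex_admissible[OF \<open>ultrafilter p\<close> J_set_of_closure_K_delta[OF p(1)] star] assms(3) by auto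
  then have adm: "admissible star D F (D F)" if "F \<in> Pf \<F>" for F
    using that by blast
  note D = admissibleD[OF adm]
  define xs where "xs F = fst (fst (D F))" for F
  define b where "b F = snd (fst (D F))" for F
  define m where "m = (\<lambda>F\<in>Pf \<F>. length (xs F))"
  \<comment> \<open>Lists count from 0 and the tuples from 1; position \<open>m F + 1\<close> holds
    the final element. The restricted abstractions provide extensionality.\<close>
  define \<alpha> where "\<alpha> = (\<lambda>F\<in>Pf \<F>. \<lambda>j\<in>{1..m F + 1}. if j \<le> m F then fst (xs F ! (j - 1)) else b F)"
  define \<tau> where "\<tau> = (\<lambda>F\<in>Pf \<F>. \<lambda>j\<in>{1..m F}. snd (xs F ! (j - 1)))"
  have m: "m F = length (xs F)" "m F \<ge> 1" if "F \<in> Pf \<F>" for F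
    using D(1)[OF that] that by (auto simp: m_def xs_def Suc_le_eq)
  have \<tau>: "\<tau> F j = snd (xs F ! (j - 1))" "\<tau> F j \<in> snd ` set (xs F)"
    if "F \<in> Pf \<F>" "j \<in> {1..m F}" for F j
    using that m(1)[OF that(1)] by (auto simp: \<tau>_def intro!: imageI nth_mem)
  have "\<tau> F \<in> increasing_tuples (m F)" if F: "F \<in> Pf \<F>" for F
  proof -
    have "\<tau> F i < \<tau> F j" if "i \<in> {1..m F}" "j \<in> {1..m F}" "i < j" for i j
      using D(2)[OF F] that m(1)[OF F] sorted_wrt_nth_less[of "(<)" "map snd (xs F)" "i - 1" "j - 1"]
      by (simp add: \<tau>(1)[OF F] xs_def)
    moreover have "\<tau> F j \<ge> 1" if "j \<in> {1..m F}" for j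
      using D(2)[OF F] \<tau>(2)[OF F that] by (auto simp: xs_def Suc_le_eq)
    moreover have "\<tau> F \<in> extensional {1..m F}"
      using F by (simp add: \<tau>_def)
    ultimately show ?thesis
      by (auto simp: increasing_tuples_def strict_mono_on_def PiE_def)
  qed
  then have \<tau>_in: "\<tau> \<in> (\<Pi>\<^sub>E F\<in>Pf \<F>. increasing_tuples (m F))"
    by (auto simp: PiE_def \<tau>_def)
  have m_in: "m \<in> Pf \<F> \<rightarrow>\<^sub>E {1..}"
    using m(2) by (auto simp: PiE_def m_def)
  have \<alpha>_in: "\<alpha> \<in> (\<Pi>\<^sub>E F\<in>Pf \<F>. {1..m F + 1} \<rightarrow>\<^sub>E (UNIV :: 'a set))"
    by (auto simp: PiE_def \<alpha>_def)
  have less: "\<tau> F (m F) < \<tau> G 1" if "F \<in> Pf \<F>" "G \<in> Pf \<F>" "F \<subset> G" for F G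
  proof (rule D(3)[OF that(2,3)])
    show "F \<noteq> {}"
      using that(1) by (simp add: Pf_def)
    show "\<tau> F (m F) \<in> snd ` set (fst (fst (D F)))"
      using \<tau>(2)[OF that(1)] m(2)[OF that(1)] by (simp add: xs_def)
    show "\<tau> G 1 \<in> snd ` set (fst (fst (D G)))"
      using \<tau>(2)[OF that(2)] m(2)[OF that(2)] by (simp add: xs_def)
  qed
  have chain: "\<exists>x \<in> A.
         ordered_prod op
           (\<lambda>i. ordered_prod op (\<lambda>j. op (\<alpha> (G i) j) (f i (\<tau> (G i) j))) {1..m (G i)} \<odot>
              Some (\<alpha> (G i) (m (G i) + 1)))
           {1..n} = Some x"
    if n: "n \<ge> 1" and G: "\<forall>i \<in> {1..n}. G i \<in> Pf \<F>" "\<forall>i \<in> {1..<n}. G i \<subset> G (i + 1)"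
      "\<forall>i \<in> {1..n}. f i \<in> G i" for n and G :: "nat \<Rightarrow> (nat \<Rightarrow> 'a) set" and f :: "nat \<Rightarrow> nat \<Rightarrow> 'a"
  proof -
    define u where "u i = ordered_prod op (\<lambda>j. op (\<alpha> (G i) j) (f i (\<tau> (G i) j))) {1..m (G i)} \<odot>
              Some (\<alpha> (G i) (m (G i) + 1))" for i
    have u: "u i = eval (f i) (xs (G i)) (b (G i))" if "i \<in> {1..n}" for i
    proof -
      have Gi: "G i \<in> Pf \<F>"
        using G(1) that by blast
      have "ordered_prod op (\<lambda>j. op (\<alpha> (G i) j) (f i (\<tau> (G i) j))) {1..m (G i)} =
          ordered_prod op (\<lambda>j. op (fst (xs (G i) ! (j - 1))) (f i (snd (xs (G i) ! (j - 1))))) {1..m (G i)}"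
        by (rule ordered_prod_cong) (use Gi \<tau>(1)[OF Gi] in \<open>simp add: \<alpha>_def\<close>)
      moreover have "\<alpha> (G i) (m (G i) + 1) = b (G i)"
        using Gi by (simp add: \<alpha>_def)
      ultimately show ?thesis
        using ordered_prod_eval[of "xs (G i)"] D(1)[OF Gi] m(1)[OF Gi] by (simp add: u_def xs_def)
    qed
    \<comment> \<open>Along the chain, the product of the first \<open>k\<close> factors is one of
      the products recorded at \<open>G k\<close>; admissibility at \<open>G (Suc k)\<close> adds
      the next factor.\<close>
    have "k \<le> n \<Longrightarrow> ordered_prod op u {1..k} \<in> snd (D (G k))" if "k \<ge> 1" for k
      using that
    proof (induction k rule: nat_induct_at_least)
      case base
      then have "1 \<in> {1..n}"
        using n by simp
      then have "u 1 \<in> snd (D (G 1))"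
        using D(4)[of "G 1" "f 1"] G(1,3) u[of 1] by (simp add: xs_def b_def)
      then show ?case
        by (simp add: ordered_prod_def)
    next
      case (Suc k)
      then have k: "k \<in> {1..<n}" "k \<in> {1..n}" "Suc k \<in> {1..n}"
        by auto
      have "G k \<in> Pf \<F>"
        using G(1) k(2) by blast
      then have "G k \<noteq> {}"
        by (simp add: Pf_def)
      moreover have "G k \<subset> G (Suc k)"
        using G(2) k(1) by simp
      moreover have "G (Suc k) \<in> Pf \<F>" "f (Suc k) \<in> G (Suc k)"
        using G(1,3) k(3) by blast+
      moreover have "ordered_prod op u {1..k} \<in> snd (D (G k))"
        using Suc by simp
      ultimately have "ordered_prod op u {1..k} \<odot> u (Suc k) \<in> snd (D (G (Suc k)))"
        using D(5)[of "G (Suc k)" "G k"] u[OF k(3)] by (simp add: xs_def b_def)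
      then show ?case
        using ordered_prod_Suc[OF Suc.hyps] by simp
    qed
    then have "ordered_prod op u {1..n} \<in> snd (D (G n))"
      using n by simp
    moreover have "G n \<in> Pf \<F>"
      using n G(1) by simp
    ultimately have "ordered_prod op u {1..n} \<in> Some ` star"
      using D(7) by blast
    then obtain x where "x \<in> star" "ordered_prod op u {1..n} = Some x"
      by blast
    then have "\<exists>x\<in>A. ordered_prod op u {1..n} = Some x"
      by (auto simp: star_def)
    then show ?thesis
      unfolding u_def[abs_def] .
  qed
  show ?thesis
  proof (intro bexI[OF _ m_in] bexI[OF _ \<alpha>_in] bexI[OF _ \<tau>_in] conjI ballI allI impI, goal_cases)
    case (1 F G)
    then show ?case
      by (rule less)
  next
    case (2 n G f)
    then show ?case
      by (elim conjE) (rule chain)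
  qed
qed

end
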